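(* Let $Y \subseteq \mathbb{Z}^n$ be a digital image with basepoint $y_0 \in Y$. The set $\pi_1(Y, y_0)$ of subdivision-based homotopy equivalence classes of based loops in $Y$, with the product $[\alpha]\cdot[\beta] = [\alpha\cdot\beta]$ induced by concatenation of based loops, is a group.
   Context: A digital image is a finite subset $Y \subseteq \mathbb{Z}^n$ with adjacency relation $x \sim_Y y$ iff $|x_i - y_i| \le 1$ for every $i=1,\dots,n$ (so each point is adjacent to itself). A function $f\colon X\to Y$ of digital images is continuous if $x\sim_X x'$ implies $f(x)\sim_Y f(x')$. $I_N = \{0,1,\dots,N\}\subseteq\mathbb{Z}$, and $I_M\times I_R \subseteq \mathbb{Z}^2$ has $(s,t)\sim(s',t')$ iff $|s-s'|\le 1$ and $|t-t'|\le 1$. A based loop of length $N\ge 1$ in $Y$ is a continuous map $\gamma\colon I_N\to Y$ with $\gamma(0)=\gamma(N)=y_0$. Based loops $\alpha,\beta\colon I_M\to Y$ of the same length are based homotopic as based loops, written $\alpha\approx\beta$, if for some $R\ge1$ there is a continuous $H\colon I_M\times I_R\to Y$ with $H(s,0)=\alpha(s)$, $H(s,R)=\beta(s)$ for all $s$ and $H(0,t)=H(M,t)=y_0$ for all $t$. For $k\ge1$, $\rho_k\colon I_{kN+k-1}\to I_N$ is $\rho_k(s)=\lfloor s/k\rfloor$. Based loops $\alpha\colon I_M\to Y$ and $\beta\colon I_N\to Y$ are subdivision-based homotopic as based loops if for some $k,l\ge1$ with $k(M+1)=l(N+1)$ we have $\alpha\circ\rho_k\approx\beta\circ\rho_l$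 as based loops. This is an equivalence relation on based loops of all lengths; $[\alpha]$ denotes the class of $\alpha$ and $\pi_1(Y,y_0)$ the set of classes. The concatenation of $\alpha\colon I_M\to Y$ and $\beta\colon I_N\to Y$ is $\alpha\cdot\beta\colon I_{M+N+1}\to Y$ with $(\alpha\cdot\beta)(t)=\alpha(t)$ for $0\le t\le M$ and $(\alpha\cdot\beta)(t)=\beta(t-(M+1))$ for $M+1\le t\le M+N+1$. The product $[\alpha]\cdot[\beta]=[\alpha\cdot\beta]$ is well defined on classes. *)

theory Defs
  imports "HOL-Analysis.Finite_Cartesian_Product" "HOL-Library.FuncSet" "HOL-Algebra.Group"
begin

text \<open>
  Points of \<open>\<int>\<^sup>n\<close> are vectors of type \<^typ>\<open>int ^ 'n\<close>.  The intervals \<open>I\<^sub>N\<close>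
  and the rectangles \<open>I\<^sub>M \<times> I\<^sub>R\<close> live in \<^typ>\<open>int\<close> and \<^typ>\<open>int \<times> int\<close> (that is,
  \<open>\<int>\<close> and \<open>\<int>\<^sup>2\<close>), each with its own copy of the adjacency relation.
\<close>

definition adj :: "int ^ 'n \<Rightarrow> int ^ 'n \<Rightarrow> bool" where
  "adj x y \<longleftrightarrow> (\<forall>i. \<bar>x $ i - y $ i\<bar> \<le> 1)"

definition adj1 :: "int \<Rightarrow> int \<Rightarrow> bool" where
  "adj1 s s' \<longleftrightarrow> \<bar>s - s'\<bar> \<le> 1"

definition adj2 :: "int \<times> int \<Rightarrow> int \<times> int \<Rightarrow> bool" where
  "adj2 p q \<longleftrightarrow> \<bar>fst p - fst q\<bar> \<le> 1 \<and> \<bar>snd p - snd q\<bar> \<le> 1"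

definition digitally_continuous ::
  "('a \<Rightarrow> 'a \<Rightarrow> bool) \<Rightarrow> 'a set \<Rightarrow> ('b \<Rightarrow> 'b \<Rightarrow> bool) \<Rightarrow> 'b set \<Rightarrow> ('a \<Rightarrow> 'b) \<Rightarrow> bool" where
  "digitally_continuous r X r' Y f \<longleftrightarrow>
     f \<in> X \<rightarrow> Y \<and> (\<forall>x\<in>X. \<forall>x'\<in>X. r x x' \<longrightarrow> r' (f x) (f x'))"

definition I :: "nat \<Rightarrow> int set" where
  "I N = {0..int N}"

text \<open>
  A map on \<open>I\<^sub>N\<close> is a pair \<open>(N, \<gamma>)\<close>.  Loops are required to be
  extensional, so that two of them are equal exactly when they have the same length and
  agree on \<open>I\<^sub>N\<close>.
\<close>

type_synonym 'n path = "nat \<times> (int \<Rightarrow> int ^ 'n)"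

definition based_loops :: "(int ^ 'n) set \<Rightarrow> int ^ 'n \<Rightarrow> 'n path set" where
  "based_loops Y y0 = {(N, \<gamma>). N \<ge> 1 \<and> \<gamma> \<in> extensional (I N) \<and>
     digitally_continuous adj1 (I N) adj Y \<gamma> \<and> \<gamma> 0 = y0 \<and> \<gamma> (int N) = y0}"

definition based_homotopic ::
  "(int ^ 'n) set \<Rightarrow> int ^ 'n \<Rightarrow> 'n path \<Rightarrow> 'n path \<Rightarrow> bool" where
  "based_homotopic Y y0 a b \<longleftrightarrow>
     a \<in> based_loops Y y0 \<and> b \<in> based_loops Y y0 \<and> fst a = fst b \<and>
     (\<exists>R\<ge>1. \<exists>H :: int \<times> int \<Rightarrow> int ^ 'n.
        digitally_continuous adj2 (I (fst a) \<times> I R) adj Y H \<and>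
        (\<forall>s\<in>I (fst a). H (s, 0) = snd a s \<and> H (s, int R) = snd b s) \<and>
        (\<forall>t\<in>I R. H (0, t) = y0 \<and> H (int (fst a), t) = y0))"

text \<open>The composite \<open>\<alpha> \<circ> \<rho>\<^sub>k\<close>, of length \<open>k N + k - 1\<close>, for \<open>k \<ge> 1\<close>.\<close>

definition subdivide :: "nat \<Rightarrow> 'n path \<Rightarrow> 'n path" where
  "subdivide k = (\<lambda>(N, \<alpha>).
     (k * N + k - 1, restrict (\<lambda>s. \<alpha> (s div int k)) (I (k * N + k - 1))))"

definition subdiv_homotopy :: "(int ^ 'n) set \<Rightarrow> int ^ 'n \<Rightarrow> 'n path rel" where
  "subdiv_homotopy Y y0 = {(a, b). a \<in> based_loops Y y0 \<and> b \<in> based_loops Y y0 \<and>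
     (\<exists>k\<ge>1. \<exists>l\<ge>1. k * (fst a + 1) = l * (fst b + 1) \<and>
        based_homotopic Y y0 (subdivide k a) (subdivide l b))}"

definition loop_class :: "(int ^ 'n) set \<Rightarrow> int ^ 'n \<Rightarrow> 'n path \<Rightarrow> 'n path set" where
  "loop_class Y y0 a = subdiv_homotopy Y y0 `` {a}"

definition loop_concat :: "'n path \<Rightarrow> 'n path \<Rightarrow> 'n path" where
  "loop_concat = (\<lambda>(M, \<alpha>) (N, \<beta>).
     (M + N + 1,
      restrict (\<lambda>t. if t \<le> int M then \<alpha> t else \<beta> (t - (int M + 1))) (I (M + N + 1))))"

definition const_loop :: "int ^ 'n \<Rightarrow> 'n path" where
  "const_loop y0 = (1, restrict (\<lambda>_. y0) (I 1))"

text \<open>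
  The product of two classes is the union of \<open>[a \<cdot> b]\<close> over all representatives; once
  concatenation is known to respect the relation, this is the single class \<open>[a \<cdot> b]\<close>.
\<close>

definition digital_pi1 :: "(int ^ 'n) set \<Rightarrow> int ^ 'n \<Rightarrow> 'n path set monoid" where
  "digital_pi1 Y y0 =
     \<lparr>carrier = based_loops Y y0 // subdiv_homotopy Y y0,
      mult = (\<lambda>A B. \<Union>a\<in>A. \<Union>b\<in>B. loop_class Y y0 (loop_concat a b)),
      one = loop_class Y y0 (const_loop y0)\<rparr>"

end

theory Submission imports Defs begin

text \<open>
  Concatenating \<open>I\<^sub>M\<close> and \<open>I\<^sub>N\<close> uses \<open>M + N + 2\<close> points, so concatenation of loops
  is strictly associative. Most of the rest follows from one idea: a loop does not change its
  class when it is traversed at another speed.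

  A homotopy may be compared across diagonals, which leaves very little freedom: an integer
  function that increases by 1 at each \<open>s\<close> cannot also move in \<open>t\<close>. Doubling the resolution restores
  the freedom. If \<open>F\<close> and \<open>G\<close> are 1-Lipschitz integer functions, the median of
  \<open>F s - t\<close>, \<open>G s\<close> and \<open>F s + t\<close> leads from \<open>F\<close> to \<open>G\<close> and varies by at most 2 across a
  diagonal, so its half varies by at most 1. Hence \<open>g (F s div 2)\<close> and \<open>g (G s div 2)\<close> are
  homotopic (\<open>based_homotopic_reparametrise\<close>). A monotone \<open>\<phi>\<close> with steps 0 and 1 becomes such
  a half after any proper subdivision, and therefore \<open>g \<circ> \<phi>\<close> and \<open>g\<close> are in the same class
  whenever \<open>\<phi>\<close> leads from the start of \<open>g\<close> to its end (\<open>subdiv_homotopy_reparametrise\<close>).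

  Three group-theoretic facts are instances. The loops \<open>(\<alpha> \<circ> \<rho>\<^sub>k) \<cdot> (\<beta> \<circ> \<rho>\<^sub>l)\<close> and
  \<open>\<alpha> \<cdot> \<beta>\<close> differ by a reparametrisation even if \<open>k \<noteq> l\<close>; this makes the product well
  defined, because two pairs of equivalent loops may need subdivisions in different ratios.
  Prefixing a loop with a constant one is a reparametrisation, and constant loops of all
  lengths are reparametrisations of each other. For inverses, \<open>\<alpha>\<close> run backwards and then
  forwards has the form \<open>\<alpha> \<circ> \<psi>\<close>, and \<open>\<alpha> (max (\<psi> s) t)\<close> cuts off more and more of the
  excursion until only the base point is left.

  Loops are extended by the base point to all of \<open>\<int>\<close>, and homotopies to all of \<open>\<int>\<^sup>2\<close>,
  which removes the range conditions from these formulas.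
\<close>

section \<open>Integer step functions\<close>

text \<open>The nearest-point retraction of \<open>\<int>\<close> onto \<open>I N\<close>.\<close>

definition clamp :: "nat \<Rightarrow> int \<Rightarrow> int" where
  "clamp N s = max 0 (min (int N) s)"

lemma clamp_lipschitz: "\<bar>clamp N s - clamp N s'\<bar> \<le> \<bar>s - s'\<bar>"
  by (auto simp: clamp_def max_def min_def)

lemma clamp_in_I [simp]: "clamp N s \<in> I N"
  by (auto simp: clamp_def I_def)

lemma clamp_id: "s \<in> I N \<Longrightarrow> clamp N s = s"
  by (auto simp: clamp_def I_def)

text \<open>Changes of speed are monotone; for monotone functions, continuity only has to be
  checked on a single forward step.\<close>

lemma mono_unit_step_lipschitz:
  fixes \<phi> :: "int \<Rightarrow> int"
  assumes "mono \<phi>" and "\<And>s. \<phi> (s + 1) \<le> \<phi> s + 1" and "\<bar>x - y\<bar> \<le> 1"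
  shows "\<bar>\<phi> x - \<phi> y\<bar> \<le> 1"
proof -
  consider "x = y" | "x = y + 1" | "y = x + 1" using assms(3) by linarith
  then show ?thesis
    by cases (use assms(2)[of y] assms(2)[of x] monoD[OF assms(1), of y "y+1"]
        monoD[OF assms(1), of x "x+1"] in auto)
qed

lemma div_unit_step:
  fixes s m :: int
  assumes "m \<ge> 1"
  shows "(s + 1) div m \<le> s div m + 1" and "m \<ge> 2 \<Longrightarrow> (s + 2) div m \<le> s div m + 1"
proof -
  have "(s + m) div m = s div m + 1" using assms by simp
  then show "(s + 1) div m \<le> s div m + 1" and "m \<ge> 2 \<Longrightarrow> (s + 2) div m \<le> s div m + 1"
    using zdiv_mono1[of "s+1" "s+m" m] zdiv_mono1[of "s+2" "s+m" m] assms by auto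
qed

lemma div_lipschitz:
  fixes x y m :: int
  assumes "m \<ge> 1" and "\<bar>x - y\<bar> \<le> 1"
  shows "\<bar>x div m - y div m\<bar> \<le> 1"
  using mono_unit_step_lipschitz[of "\<lambda>s. s div m"] div_unit_step(1)[OF assms(1)] assms
  by (auto simp: mono_def zdiv_mono1)

lemma le_div_iff_mult_le:
  fixes n s k :: int
  assumes "k \<ge> 1"
  shows "n \<le> s div k \<longleftrightarrow> n * k \<le> s"
proof
  assume "n \<le> s div k"
  then have "n * k \<le> s div k * k" using assms by (intro mult_right_mono) auto
  also have "\<dots> \<le> s" using assms pos_mod_sign[of k s] div_mult_mod_eq[of s k] by linarith
  finally show "n * k \<le> s" .
next
  assume "n * k \<le> s"
  then have "n * k div k \<le> s div k" using assms by (intro zdiv_mono1) auto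
  then show "n \<le> s div k" using assms by simp
qed

text \<open>Halving trades the Lipschitz constant 2, the most that the sum of a step in \<open>s\<close> and a
  step in \<open>t\<close> can produce, for the constant 1 that continuity asks for.\<close>

lemma half_lipschitz:
  fixes x y :: int
  assumes "\<bar>x - y\<bar> \<le> 2"
  shows "\<bar>x div 2 - y div 2\<bar> \<le> 1"
  using assms by linarith

section \<open>Loops and homotopies extended by the base point\<close>

text \<open>Constant continuation: both endpoints of a loop are the base point, so the values outside
  \<open>I N\<close> are the base point.\<close>

definition extend :: "('n::finite) path \<Rightarrow> int \<Rightarrow> int ^ 'n" where
  "extend a s = snd a (clamp (fst a) s)"

definition path_of :: "nat \<Rightarrow> (int \<Rightarrow> int ^ 'n) \<Rightarrow> ('n::finite) path" where
  "path_of N g = (N, restrict g (I N))"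

definition reverse_loop :: "('n::finite) path \<Rightarrow> 'n path" where
  "reverse_loop a = path_of (fst a) (\<lambda>s. extend a (int (fst a) - s))"

lemma adj_refl [simp]: "adj x x"
  by (simp add: adj_def)

lemma adj_sym: "adj x y \<Longrightarrow> adj y x"
  by (simp add: adj_def abs_minus_commute)

lemma fst_path_of [simp]: "fst (path_of N g) = N"
  by (simp add: path_of_def)

lemma path_of_cong: "(\<And>s. s \<in> I N \<Longrightarrow> g s = h s) \<Longrightarrow> path_of N g = path_of N h"
  by (auto simp: path_of_def)

lemma subdivide_1:
  assumes "a \<in> based_loops Y y0"
  shows "subdivide 1 a = a"
  using assms by (auto simp: subdivide_def based_loops_def extensional_restrict)

locale pointed_image =
  fixes Y :: "(int ^ 'n) set" and y0 :: "int ^ 'n"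
  assumes base_in [simp]: "y0 \<in> Y"
begin

text \<open>Maps that are the extension of a loop; for \<open>N \<ge> 1\<close> they correspond bijectively to the
  based loops of length \<open>N\<close> by \<^const>\<open>extend\<close> and \<^const>\<open>path_of\<close>.\<close>

definition loop_map :: "nat \<Rightarrow> (int \<Rightarrow> int ^ 'n) \<Rightarrow> bool" where
  "loop_map N g \<longleftrightarrow> digitally_continuous adj1 UNIV adj Y g \<and>
     (\<forall>s. s \<le> 0 \<or> int N \<le> s \<longrightarrow> g s = y0)"

definition loop_homotopy :: "nat \<Rightarrow> (int \<times> int \<Rightarrow> int ^ 'n) \<Rightarrow> bool" where
  "loop_homotopy N H \<longleftrightarrow> digitally_continuous adj2 UNIV adj Y H \<and>
     (\<forall>s t. s \<le> 0 \<or> int N \<le> s \<longrightarrow> H (s, t) = y0)"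

lemma loop_mapI:
  assumes "\<And>s. g s \<in> Y" and "\<And>s s'. \<bar>s - s'\<bar> \<le> 1 \<Longrightarrow> adj (g s) (g s')"
    and "\<And>s. s \<le> 0 \<Longrightarrow> g s = y0" and "\<And>s. int N \<le> s \<Longrightarrow> g s = y0"
  shows "loop_map N g"
  using assms by (auto simp: loop_map_def digitally_continuous_def adj1_def)

lemma loop_mapD:
  assumes "loop_map N g"
  shows "g s \<in> Y" and "\<bar>s - s'\<bar> \<le> 1 \<Longrightarrow> adj (g s) (g s')"
    and "s \<le> 0 \<Longrightarrow> g s = y0" and "int N \<le> s \<Longrightarrow> g s = y0"
  using assms by (auto simp: loop_map_def digitally_continuous_def adj1_def)

lemma loop_homotopyI:
  assumes "\<And>s t. H (s, t) \<in> Y"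
    and "\<And>s t s' t'. \<bar>s - s'\<bar> \<le> 1 \<Longrightarrow> \<bar>t - t'\<bar> \<le> 1 \<Longrightarrow> adj (H (s, t)) (H (s', t'))"
    and "\<And>s t. s \<le> 0 \<Longrightarrow> H (s, t) = y0" and "\<And>s t. int N \<le> s \<Longrightarrow> H (s, t) = y0"
  shows "loop_homotopy N H"
  using assms by (auto simp: loop_homotopy_def digitally_continuous_def adj2_def)

lemma loop_homotopyD:
  assumes "loop_homotopy N H"
  shows "H (s, t) \<in> Y"
    and "\<bar>s - s'\<bar> \<le> 1 \<Longrightarrow> \<bar>t - t'\<bar> \<le> 1 \<Longrightarrow> adj (H (s, t)) (H (s', t'))"
    and "s \<le> 0 \<Longrightarrow> H (s, t) = y0" and "int N \<le> s \<Longrightarrow> H (s, t) = y0"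
  using assms by (auto simp: loop_homotopy_def digitally_continuous_def adj2_def)

lemma loop_homotopy_slice: "loop_homotopy N H \<Longrightarrow> loop_map N (\<lambda>s. H (s, t))"
  by (rule loop_mapI) (auto intro: loop_homotopyD)

lemma extend_path_of:
  assumes "loop_map N g"
  shows "extend (path_of N g) = g"
proof
  fix s
  have "g (clamp N s) = g s"
    using loop_mapD(3,4)[OF assms] by (auto simp: clamp_def max_def min_def)
  then show "extend (path_of N g) s = g s"
    by (simp add: extend_def path_of_def)
qed

lemma path_of_extend: "a \<in> based_loops Y y0 \<Longrightarrow> path_of (fst a) (extend a) = a"
  by (auto simp: based_loops_def path_of_def extend_def clamp_id extensional_def fun_eq_iff)

lemma loop_map_extend:
  assumes "a \<in> based_loops Y y0"
  shows "loop_map (fst a) (extend a)"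
proof (rule loop_mapI)
  have a: "digitally_continuous adj1 (I (fst a)) adj Y (snd a)"
    "snd a 0 = y0" "snd a (int (fst a)) = y0"
    using assms by (auto simp: based_loops_def)
  show "extend a s \<in> Y" for s
    using a(1) by (auto simp: digitally_continuous_def extend_def)
  show "adj (extend a s) (extend a s')" if "\<bar>s - s'\<bar> \<le> 1" for s s'
    using a(1) clamp_lipschitz[of "fst a" s s'] that
    by (auto simp: digitally_continuous_def extend_def adj1_def)
  show "extend a s = y0" if "s \<le> 0" for s
    using that a by (simp add: extend_def clamp_def)
  show "extend a s = y0" if "int (fst a) \<le> s" for s
    using that a by (simp add: extend_def clamp_def)
qed

lemma path_of_loop:
  assumes "loop_map N g" and "N \<ge> 1"
  shows "path_of N g \<in> based_loops Y y0"
  using assms unfolding loop_map_def path_of_def based_loops_def digitally_continuous_def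
  by (auto simp: I_def)

lemma loop_cases:
  assumes "a \<in> based_loops Y y0"
  obtains N g where "N \<ge> 1" and "loop_map N g" and "a = path_of N g"
  using that[OF _ loop_map_extend[OF assms] path_of_extend[OF assms, symmetric]] assms
  by (auto simp: based_loops_def)

lemma subdivide_path_of:
  assumes "k \<ge> 1"
  shows "subdivide k (path_of N g) = path_of (k * N + k - 1) (\<lambda>s. g (s div int k))"
proof -
  have "s div int k \<in> I N" if "s \<in> I (k * N + k - 1)" for s
  proof -
    have "s < (int N + 1) * int k" "0 \<le> s"
      using that assms by (auto simp: I_def algebra_simps of_nat_diff)
    then show ?thesis
      using assms le_div_iff_mult_le[of "int k" "int N + 1" s]
      by (auto simp: I_def pos_imp_zdiv_nonneg_iff)
  qed
  then show ?thesis
    by (auto simp: subdivide_def path_of_def)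
qed

text \<open>Subdivision keeps the start and the end of a loop in place, also for the extended maps.\<close>

lemma div_past_end:
  assumes "k \<ge> 1" and "int (k * N + k - 1) \<le> s"
  shows "int N \<le> s div int k"
  using assms le_div_iff_mult_le[of "int k" "int N" s]
  by (auto simp: algebra_simps of_nat_diff)

lemma div_before_start:
  assumes "k \<ge> 1" and "s \<le> 0"
  shows "s div int k \<le> 0"
  using assms zdiv_mono1[of s 0 "int k"] by simp

lemma subdivide_subdivide:
  assumes "a \<in> based_loops Y y0" and "k \<ge> 1" and "l \<ge> 1"
  shows "subdivide k (subdivide l a) = subdivide (k * l) a"
proof -
  obtain N g where a: "N \<ge> 1" "loop_map N g" "a = path_of N g"
    using loop_cases[OF assms(1)] .
  have "k * (l * N + l - 1) + k = k * (l * N + l - 1 + 1)" by simp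
  also have "l * N + l - 1 + 1 = l * N + l" using assms(3) by simp
  finally have "k * (l * N + l - 1) + k - 1 = k * l * N + k * l - 1"
    by (simp add: algebra_simps)
  then show ?thesis
    using assms(2,3) by (simp add: a(3) subdivide_path_of zdiv_zmult2_eq Suc_le_eq)
qed

lemma loop_concat_path_of:
  "loop_concat (path_of M g) (path_of N h) =
     path_of (M + N + 1) (\<lambda>s. if s \<le> int M then g s else h (s - (int M + 1)))"
  by (auto simp: loop_concat_def path_of_def I_def restrict_def fun_eq_iff)

text \<open>At the seam the map stays at \<open>y0\<close>: \<open>M\<close> and \<open>M + 1\<close> both have this value.\<close>

lemma loop_map_concat:
  assumes g: "loop_map M g" and h: "loop_map N h"
  shows "loop_map (M + N + 1) (\<lambda>s. if s \<le> int M then g s else h (s - (int M + 1)))"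
    (is "loop_map _ ?c")
proof (rule loop_mapI)
  show "?c s \<in> Y" for s
    using loop_mapD(1)[OF g] loop_mapD(1)[OF h] by auto
  show "?c s = y0" if "s \<le> 0" for s
    using that loop_mapD(3)[OF g] by auto
  show "?c s = y0" if "int (M + N + 1) \<le> s" for s
    using that loop_mapD(4)[OF h] by auto
  have *: "adj (?c s) (?c s')" if "\<bar>s - s'\<bar> \<le> 1" "s \<le> s'" for s s'
  proof -
    consider "s' \<le> int M" | "s = int M" "s' = int M + 1" | "s > int M"
      using \<open>\<bar>s - s'\<bar> \<le> 1\<close> \<open>s \<le> s'\<close> by linarith
    then show ?thesis
      using that loop_mapD(2)[OF g, of s s'] loop_mapD(2)[OF h, of "s - (int M + 1)" "s' - (int M + 1)"]
      by cases (simp_all add: loop_mapD(4)[OF g] loop_mapD(3)[OF h])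
  qed
  show "adj (?c s) (?c s')" if "\<bar>s - s'\<bar> \<le> 1" for s s'
    using *[of s s'] *[of s' s] that by (cases "s \<le> s'") (auto intro: adj_sym)
qed

lemma loop_concat_loop:
  assumes "a \<in> based_loops Y y0" and "b \<in> based_loops Y y0"
  shows "loop_concat a b \<in> based_loops Y y0"
proof -
  obtain M g where a: "loop_map M g" "a = path_of M g" using loop_cases[OF assms(1)] .
  obtain N h where b: "loop_map N h" "b = path_of N h" using loop_cases[OF assms(2)] .
  show ?thesis
    unfolding a(2) b(2) loop_concat_path_of
    by (rule path_of_loop[OF loop_map_concat[OF a(1) b(1)]]) simp
qed

text \<open>The seam costs an additional point in both bracketings, so the lengths and the maps
  agree exactly, without a homotopy.\<close>

lemma loop_concat_assoc:
  assumes "a \<in> based_loops Y y0" and "b \<in> based_loops Y y0" and "c \<in> based_loops Y y0"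
  shows "loop_concat (loop_concat a b) c = loop_concat a (loop_concat b c)"
proof -
  obtain M f where "a = path_of M f" using loop_cases[OF assms(1)] .
  moreover obtain N g where "b = path_of N g" using loop_cases[OF assms(2)] .
  moreover obtain P h where "c = path_of P h" using loop_cases[OF assms(3)] .
  ultimately show ?thesis
    by (auto simp: loop_concat_path_of algebra_simps intro!: path_of_cong)
qed

text \<open>With the next two lemmas a homotopy can be used in its extended form. In particular the
  height \<open>R\<close> may be 0 in the introduction rule: stopping the time at \<open>R\<close> allows for one more
  row.\<close>

lemma based_homotopicI:
  assumes H: "loop_homotopy N H" and N: "N \<ge> 1"
    and a: "\<And>s. s \<in> I N \<Longrightarrow> H (s, 0) = g s"
    and b: "\<And>s. s \<in> I N \<Longrightarrow> H (s, int R) = h s"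
  shows "based_homotopic Y y0 (path_of N g) (path_of N h)"
proof -
  have g: "path_of N g = path_of N (\<lambda>s. H (s, 0))"
    and h: "path_of N h = path_of N (\<lambda>s. H (s, int R))"
    by (auto intro!: path_of_cong simp: a b)
  \<comment> \<open>After time \<open>R\<close> the homotopy rests, which gives the positive height \<open>R + 1\<close>.\<close>
  define H' where "H' = (\<lambda>(s, t). H (s, min t (int R)))"
  have "digitally_continuous adj2 (I N \<times> I (R + 1)) adj Y H'"
    using loop_homotopyD[OF H] by (auto simp: digitally_continuous_def adj2_def H'_def)
  moreover have "\<forall>s\<in>I N. H' (s, 0) = snd (path_of N g) s \<and> H' (s, int (R + 1)) = snd (path_of N h) s"
    by (auto simp: H'_def path_of_def a b)
  moreover have "\<forall>t\<in>I (R + 1). H' (0, t) = y0 \<and> H' (int N, t) = y0"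
    using loop_homotopyD(3,4)[OF H] by (auto simp: H'_def)
  moreover have "path_of N g \<in> based_loops Y y0" "path_of N h \<in> based_loops Y y0"
    unfolding g h by (auto intro!: path_of_loop loop_homotopy_slice H N)
  ultimately show ?thesis
    unfolding based_homotopic_def fst_path_of by (intro conjI exI[of _ "R + 1"] exI[of _ H']) auto
qed

lemma based_homotopicE:
  assumes "based_homotopic Y y0 a b"
  obtains N R H where "N \<ge> 1" and "loop_homotopy N H"
    and "a = path_of N (\<lambda>s. H (s, 0))" and "b = path_of N (\<lambda>s. H (s, int R))"
proof -
  define N where "N = fst a"
  obtain R K where K: "digitally_continuous adj2 (I N \<times> I R) adj Y K"
    and ends: "\<And>s. s \<in> I N \<Longrightarrow> K (s, 0) = snd a s \<and> K (s, int R) = snd b s"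
    and edges: "\<And>t. t \<in> I R \<Longrightarrow> K (0, t) = y0 \<and> K (int N, t) = y0"
    and a: "a \<in> based_loops Y y0" and b: "b \<in> based_loops Y y0" and "fst b = N"
    using assms unfolding based_homotopic_def N_def by metis
  define H where "H = (\<lambda>(s, t). K (clamp N s, clamp R t))"
  have H: "loop_homotopy N H"
  proof (rule loop_homotopyI)
    show "H (s, t) \<in> Y" for s t
      using K by (auto simp: digitally_continuous_def H_def)
    show "adj (H (s, t)) (H (s', t'))" if "\<bar>s - s'\<bar> \<le> 1" "\<bar>t - t'\<bar> \<le> 1" for s t s' t'
      using K that clamp_lipschitz[of N s s'] clamp_lipschitz[of R t t']
      by (auto simp: digitally_continuous_def H_def adj2_def)
    show "H (s, t) = y0" if "s \<le> 0" for s t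
      using that edges[of "clamp R t"] by (auto simp: H_def clamp_def[of N])
    show "H (s, t) = y0" if "int N \<le> s" for s t
      using that edges[of "clamp R t"] by (auto simp: H_def clamp_def[of N])
  qed
  have "a = path_of N (\<lambda>s. H (s, 0))" "b = path_of N (\<lambda>s. H (s, int R))"
    using path_of_extend[OF a] path_of_extend[OF b] ends \<open>fst b = N\<close>
    by (auto simp: N_def[symmetric] extend_def[abs_def] H_def clamp_def[of R])
  moreover have "N \<ge> 1" using a by (auto simp: N_def based_loops_def)
  ultimately show ?thesis using that H by blast
qed

lemma based_homotopic_refl:
  assumes "a \<in> based_loops Y y0"
  shows "based_homotopic Y y0 a a"
proof -
  obtain N g where a: "N \<ge> 1" "loop_map N g" "a = path_of N g"
    using loop_cases[OF assms] .
  have "loop_homotopy N (\<lambda>(s, t). g s)"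
    using loop_mapD[OF a(2)] by (intro loop_homotopyI) auto
  from based_homotopicI[OF this a(1), where g = g and h = g] show ?thesis
    by (simp add: a(3))
qed

lemma based_homotopic_sym:
  assumes "based_homotopic Y y0 a b"
  shows "based_homotopic Y y0 b a"
proof -
  obtain N R H where H: "N \<ge> 1" "loop_homotopy N H"
    "a = path_of N (\<lambda>s. H (s, 0))" "b = path_of N (\<lambda>s. H (s, int R))"
    using based_homotopicE[OF assms] .
  have "loop_homotopy N (\<lambda>(s, t). H (s, int R - t))"
    using loop_homotopyD[OF H(2)] by (intro loop_homotopyI) auto
  from based_homotopicI[OF this H(1), where g = "\<lambda>s. H (s, int R)" and R = R and h = "\<lambda>s. H (s, 0)"] show ?thesis
    by (simp add: H(3,4))
qed

lemma based_homotopic_trans: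
  assumes "based_homotopic Y y0 a b" and "based_homotopic Y y0 b c"
  shows "based_homotopic Y y0 a c"
proof -
  obtain N R H where H: "N \<ge> 1" "loop_homotopy N H"
    "a = path_of N (\<lambda>s. H (s, 0))" "b = path_of N (\<lambda>s. H (s, int R))"
    using based_homotopicE[OF assms(1)] .
  obtain N' Q K where K: "loop_homotopy N' K"
    "b = path_of N' (\<lambda>s. K (s, 0))" "c = path_of N' (\<lambda>s. K (s, int Q))"
    using based_homotopicE[OF assms(2)] .
  have [simp]: "N' = N"
    using H(4) K(2) by (metis fst_path_of)
  \<comment> \<open>Both are the extension of \<open>b\<close>, so the two homotopies can be stacked with a common row.\<close>
  have "(\<lambda>s. H (s, int R)) = (\<lambda>s. K (s, 0))"
    using H(4) K(2) extend_path_of[OF loop_homotopy_slice[OF H(2), of "int R"]]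
      extend_path_of[OF loop_homotopy_slice[OF K(1), of 0]] by simp
  then have glue: "H (s, int R) = K (s, 0)" for s by metis
  define G where "G = (\<lambda>(s, t). if t \<le> int R then H (s, t) else K (s, t - int R))"
  have "loop_homotopy N G"
  proof (rule loop_homotopyI)
    show "G (s, t) \<in> Y" "s \<le> 0 \<Longrightarrow> G (s, t) = y0" "int N \<le> s \<Longrightarrow> G (s, t) = y0" for s t
      using loop_homotopyD[OF H(2)] loop_homotopyD[OF K(1)] by (auto simp: G_def)
    have *: "adj (G (s, t)) (G (s', t'))"
      if near: "\<bar>s - s'\<bar> \<le> 1" "\<bar>t - t'\<bar> \<le> 1" "t \<le> t'" for s t s' t'
    proof -
      consider "t' \<le> int R" | "t = int R" "t' = int R + 1" | "t > int R"
        using near by linarith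
      then show ?thesis
        using near loop_homotopyD(2)[OF H(2), of s s' t t']
          loop_homotopyD(2)[OF K(1), of s s' "t - int R" "t' - int R"]
        by cases (simp_all add: G_def glue)
    qed
    show "adj (G (s, t)) (G (s', t'))" if "\<bar>s - s'\<bar> \<le> 1" "\<bar>t - t'\<bar> \<le> 1" for s t s' t'
      using *[of s s' t t'] *[of s' s t' t] that by (cases "t \<le> t'") (auto intro: adj_sym)
  qed
  from based_homotopicI[OF this H(1), where g = "\<lambda>s. H (s, 0)" and R = "R + Q" and h = "\<lambda>s. K (s, int Q)"]
  show ?thesis
    using glue by (auto simp: H(3) K(3) G_def)
qed

lemma based_homotopic_subdivide:
  assumes "based_homotopic Y y0 a b" and "k \<ge> 1"
  shows "based_homotopic Y y0 (subdivide k a) (subdivide k b)"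
proof -
  obtain N R H where H: "N \<ge> 1" "loop_homotopy N H"
    "a = path_of N (\<lambda>s. H (s, 0))" "b = path_of N (\<lambda>s. H (s, int R))"
    using based_homotopicE[OF assms(1)] .
  have "loop_homotopy (k * N + k - 1) (\<lambda>(s, t). H (s div int k, t))"
  proof (rule loop_homotopyI; unfold prod.case)
    show "H (s div int k, t) = y0" if "s \<le> 0" for s t
      by (intro loop_homotopyD(3)[OF H(2)] div_before_start assms(2) that)
    show "H (s div int k, t) = y0" if "int (k * N + k - 1) \<le> s" for s t
      by (intro loop_homotopyD(4)[OF H(2)] div_past_end assms(2) that)
    show "adj (H (s div int k, t)) (H (s' div int k, t'))"
      if "\<bar>s - s'\<bar> \<le> 1" "\<bar>t - t'\<bar> \<le> 1" for s t s' t'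
      using assms(2) that by (intro loop_homotopyD(2)[OF H(2)] div_lipschitz) auto
  qed (rule loop_homotopyD(1)[OF H(2)])
  moreover have "k * N + k - 1 \<ge> 1"
    using H(1) assms(2) mult_le_mono[of 1 k 1 N] by linarith
  ultimately show ?thesis
    unfolding H(3,4) subdivide_path_of[OF assms(2)] by (intro based_homotopicI[where R = R]) auto
qed

text \<open>The homotopies may have different heights; each rests once it is finished.\<close>

lemma based_homotopic_concat:
  assumes "based_homotopic Y y0 a a'" and "based_homotopic Y y0 b b'"
  shows "based_homotopic Y y0 (loop_concat a b) (loop_concat a' b')"
proof -
  obtain M R H where H: "M \<ge> 1" "loop_homotopy M H"
    "a = path_of M (\<lambda>s. H (s, 0))" "a' = path_of M (\<lambda>s. H (s, int R))"
    using based_homotopicE[OF assms(1)] .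
  obtain N Q K where K: "N \<ge> 1" "loop_homotopy N K"
    "b = path_of N (\<lambda>s. K (s, 0))" "b' = path_of N (\<lambda>s. K (s, int Q))"
    using based_homotopicE[OF assms(2)] .
  define G where "G = (\<lambda>(s, t). if s \<le> int M then H (s, min t (int R))
     else K (s - (int M + 1), min t (int Q)))"
  have "loop_homotopy (M + N + 1) G"
  proof (rule loop_homotopyI)
    show "G (s, t) \<in> Y" "s \<le> 0 \<Longrightarrow> G (s, t) = y0" "int (M + N + 1) \<le> s \<Longrightarrow> G (s, t) = y0" for s t
      using loop_homotopyD[OF H(2)] loop_homotopyD[OF K(2)] by (auto simp: G_def)
    have *: "adj (G (s, t)) (G (s', t'))"
      if near: "\<bar>s - s'\<bar> \<le> 1" "\<bar>t - t'\<bar> \<le> 1" "s \<le> s'" for s t s' t'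
    proof -
      consider "s' \<le> int M" | "s = int M" "s' = int M + 1" | "s > int M"
        using near by linarith
      then show ?thesis
        using near loop_homotopyD(2)[OF H(2), of s s' "min t (int R)" "min t' (int R)"]
          loop_homotopyD(2)[OF K(2), of "s - (int M + 1)" "s' - (int M + 1)"
            "min t (int Q)" "min t' (int Q)"]
        by cases (simp_all add: G_def loop_homotopyD(4)[OF H(2)] loop_homotopyD(3)[OF K(2)])
    qed
    show "adj (G (s, t)) (G (s', t'))" if "\<bar>s - s'\<bar> \<le> 1" "\<bar>t - t'\<bar> \<le> 1" for s t s' t'
      using *[of s s' t t'] *[of s' s t' t] that by (cases "s \<le> s'") (auto intro: adj_sym)
  qed
  then show ?thesis
    unfolding H(3,4) K(3,4) loop_concat_path_of
    by (rule based_homotopicI[where R = "max R Q"]) (auto simp: G_def)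
qed

section \<open>Changing the speed of a loop\<close>

text \<open>\<open>F\<close> is pushed towards \<open>G\<close> at unit speed: at time \<open>t\<close> the value is the median of
  \<open>F s - t\<close>, \<open>G s\<close> and \<open>F s + t\<close>. It varies by at most 2 between diagonal neighbours, so
  its half is continuous. It always lies between \<open>F s\<close> and \<open>G s\<close>, so at both ends it stays
  in the region where \<open>g\<close> is the base point.\<close>

lemma based_homotopic_reparametrise:
  fixes F G :: "int \<Rightarrow> int"
  assumes g: "loop_map K g" and L: "L \<ge> 1"
    and F: "\<And>s s'. \<bar>s - s'\<bar> \<le> 1 \<Longrightarrow> \<bar>F s - F s'\<bar> \<le> 1"
    and G: "\<And>s s'. \<bar>s - s'\<bar> \<le> 1 \<Longrightarrow> \<bar>G s - G s'\<bar> \<le> 1"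
    and start: "\<And>s. s \<le> 0 \<Longrightarrow> F s \<le> 1 \<and> G s \<le> 1"
    and finish: "\<And>s. int L \<le> s \<Longrightarrow> 2 * int K \<le> F s \<and> 2 * int K \<le> G s"
  shows "based_homotopic Y y0 (path_of L (\<lambda>s. g (F s div 2))) (path_of L (\<lambda>s. g (G s div 2)))"
proof -
  define m where "m = (\<lambda>s t. max (F s - t) (min (G s) (F s + t)))"
  \<comment> \<open>Negative times are cut off, since for \<open>t < 0\<close> the formula is no median.\<close>
  define t0 :: "int \<Rightarrow> int" where "t0 = (\<lambda>t. max 0 t)"
  define H where "H = (\<lambda>(s, t). g (m s (t0 t) div 2))"
  \<comment> \<open>Any bound for the distance of \<open>F\<close> and \<open>G\<close> on \<open>I L\<close> is a sufficient time.\<close>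
  define R where "R = nat (\<Sum>s\<in>I L. \<bar>F s - G s\<bar>)"
  have R: "\<bar>F s - G s\<bar> \<le> int R" if "s \<in> I L" for s
    using that member_le_sum[of s "I L" "\<lambda>s. \<bar>F s - G s\<bar>"]
    by (auto simp: R_def I_def)
  have "loop_homotopy L H"
  proof (rule loop_homotopyI)
    show "H (s, t) \<in> Y" for s t
      using loop_mapD(1)[OF g] by (simp add: H_def)
    show "adj (H (s, t)) (H (s', t'))" if "\<bar>s - s'\<bar> \<le> 1" "\<bar>t - t'\<bar> \<le> 1" for s t s' t'
    proof -
      have "\<bar>m s (t0 t) - m s' (t0 t')\<bar> \<le> 2"
        using F[OF that(1)] G[OF that(1)] that(2) unfolding m_def t0_def by linarith
      then show ?thesis
        unfolding H_def by (auto intro: loop_mapD(2)[OF g] half_lipschitz)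
    qed
    show "H (s, t) = y0" if "s \<le> 0" for s t
    proof -
      have "m s (t0 t) \<le> 1" using start[OF that] unfolding m_def t0_def by linarith
      then show ?thesis by (auto simp: H_def intro: loop_mapD(3)[OF g])
    qed
    show "H (s, t) = y0" if "int L \<le> s" for s t
    proof -
      have "m s (t0 t) \<ge> 2 * int K" using finish[OF that] unfolding m_def t0_def by linarith
      then show ?thesis by (auto simp: H_def intro: loop_mapD(4)[OF g])
    qed
  qed
  then show ?thesis
  proof (rule based_homotopicI[where R = R])
    show "H (s, 0) = g (F s div 2)" if "s \<in> I L" for s
      by (simp add: H_def m_def t0_def)
    show "H (s, int R) = g (G s div 2)" if "s \<in> I L" for s
    proof -
      have "m s (int R) = G s" using R[OF that] unfolding m_def by linarith
      then show ?thesis by (simp add: H_def t0_def)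
    qed
  qed (rule L)
qed

lemma subdiv_homotopyI:
  assumes "a \<in> based_loops Y y0" and "b \<in> based_loops Y y0" and "k \<ge> 1" and "l \<ge> 1"
    and "based_homotopic Y y0 (subdivide k a) (subdivide l b)"
  shows "(a, b) \<in> subdiv_homotopy Y y0"
proof -
  have "fst (subdivide k a) + 1 = k * (fst a + 1)" "fst (subdivide l b) + 1 = l * (fst b + 1)"
    using assms(3,4) by (auto simp: subdivide_def split: prod.splits)
  moreover have "fst (subdivide k a) = fst (subdivide l b)"
    using assms(5) by (simp add: based_homotopic_def)
  ultimately have "k * (fst a + 1) = l * (fst b + 1)" by simp
  with assms show ?thesis unfolding subdiv_homotopy_def by blast
qed

lemma subdiv_homotopyE:
  assumes "(a, b) \<in> subdiv_homotopy Y y0"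
  obtains k l where "a \<in> based_loops Y y0" "b \<in> based_loops Y y0" "k \<ge> 1" "l \<ge> 1"
    "based_homotopic Y y0 (subdivide k a) (subdivide l b)"
  using assms unfolding subdiv_homotopy_def by blast

lemma based_homotopic_imp_subdiv_homotopy:
  assumes "based_homotopic Y y0 a b"
  shows "(a, b) \<in> subdiv_homotopy Y y0"
proof -
  have "a \<in> based_loops Y y0" "b \<in> based_loops Y y0"
    using assms by (auto simp: based_homotopic_def)
  then show ?thesis
    using assms by (intro subdiv_homotopyI[of a b 1 1]) (simp_all add: subdivide_1[of _ Y y0, simplified])
qed

text \<open>For transitivity the two subdivisions of the middle loop are refined to a common one.\<close>

lemma equiv_subdiv_homotopy: "equiv (based_loops Y y0) (subdiv_homotopy Y y0)"
proof (rule equivI)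
  show "subdiv_homotopy Y y0 \<subseteq> based_loops Y y0 \<times> based_loops Y y0"
    by (auto simp: subdiv_homotopy_def)
  show "refl_on (based_loops Y y0) (subdiv_homotopy Y y0)"
    by (auto simp: refl_on_def intro: based_homotopic_imp_subdiv_homotopy based_homotopic_refl)
  show "sym (subdiv_homotopy Y y0)"
    by (auto simp: sym_def elim!: subdiv_homotopyE
        intro: subdiv_homotopyI based_homotopic_sym)
  show "trans (subdiv_homotopy Y y0)"
  proof (rule transI)
    fix a b c
    assume "(a, b) \<in> subdiv_homotopy Y y0" "(b, c) \<in> subdiv_homotopy Y y0"
    then obtain k l m n where ab: "a \<in> based_loops Y y0" "b \<in> based_loops Y y0" "k \<ge> 1" "l \<ge> 1"
        "based_homotopic Y y0 (subdivide k a) (subdivide l b)"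
      and bc: "c \<in> based_loops Y y0" "m \<ge> 1" "n \<ge> 1"
        "based_homotopic Y y0 (subdivide m b) (subdivide n c)"
      by (metis subdiv_homotopyE)
    have "based_homotopic Y y0 (subdivide (m * k) a) (subdivide (m * l) b)"
      using based_homotopic_subdivide[OF ab(5), of m] ab bc by (simp add: subdivide_subdivide)
    moreover have "based_homotopic Y y0 (subdivide (m * l) b) (subdivide (l * n) c)"
      using based_homotopic_subdivide[OF bc(4), of l] ab bc
      by (simp add: subdivide_subdivide mult.commute[of l m])
    ultimately have "based_homotopic Y y0 (subdivide (m * k) a) (subdivide (l * n) c)"
      by (rule based_homotopic_trans)
    then show "(a, c) \<in> subdiv_homotopy Y y0"
      using ab bc by (intro subdiv_homotopyI[of a c "m * k" "l * n"]) auto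
  qed
qed

text \<open>Subdividing \<open>g \<circ> \<phi>\<close> by \<open>m = K + 1\<close>, and \<open>g\<close> by \<open>n = L + 1\<close>, makes the lengths equal.
  As \<open>m \<ge> 2\<close>, at most every second step of \<open>s div m\<close> is a jump. Then
  \<open>\<phi> (s div m) + \<phi> ((s + 1) div m)\<close> distributes twice the step of \<open>\<phi>\<close> over two consecutive
  \<open>s\<close>: it is 1-Lipschitz, and its half is \<open>\<phi> (s div m)\<close>, as the second summand exceeds the
  first by 0 or 1. The same holds for the identity in place of \<open>\<phi>\<close>.\<close>

lemma subdiv_homotopy_reparametrise:
  assumes g: "loop_map K g" and K: "K \<ge> 1" and L: "L \<ge> 1"
    and mono: "mono \<phi>" and step: "\<And>s. \<phi> (s + 1) \<le> \<phi> s + 1"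
    and start: "\<phi> 0 \<le> 0" and finish: "int K \<le> \<phi> (int L)"
  shows "(path_of L (\<lambda>s. g (\<phi> s)), path_of K g) \<in> subdiv_homotopy Y y0"
proof -
  define m where "m = K + 1"
  define n where "n = L + 1"
  have [simp]: "m \<ge> 2" "n \<ge> 2" using K L by (auto simp: m_def n_def)
  then have mn [simp]: "m \<ge> 1" "n \<ge> 1" by linarith+
  define P where "P = m * L + m - 1"
  have P: "P = n * K + n - 1" "P \<ge> 1"
    using K by (auto simp: P_def m_def n_def algebra_simps)
  have phi_end: "int K \<le> \<phi> s" if "int L \<le> s" for s
    using finish monoD[OF mono that] by simp
  have phi_start: "\<phi> s \<le> 0" if "s \<le> 0" for s
    using start monoD[OF mono that] by simp
  define spread where "spread = (\<lambda>(\<psi> :: int \<Rightarrow> int) (k :: nat) s. \<psi> (s div int k) + \<psi> ((s + 1) div int k))"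
  have lip: "\<bar>spread \<psi> k s - spread \<psi> k s'\<bar> \<le> 1"
    if "mono \<psi>" "\<And>s. \<psi> (s + 1) \<le> \<psi> s + 1" "k \<ge> 2" "\<bar>s - s'\<bar> \<le> 1" for \<psi> k s s'
  proof (rule mono_unit_step_lipschitz[OF _ _ that(4)])
    show "mono (spread \<psi> k)"
      unfolding spread_def using that(3)
      by (intro monoI add_mono monoD[OF that(1)] zdiv_mono1) auto
    show "spread \<psi> k (s + 1) \<le> spread \<psi> k s + 1" for s
    proof -
      have "(s + 2) div int k \<le> s div int k + 1"
        using div_unit_step(2)[of "int k" s] that(3) by simp
      then have "\<psi> ((s + 2) div int k) \<le> \<psi> (s div int k) + 1"
        using monoD[OF that(1)] that(2) by (meson order_trans)
      then show ?thesis by (simp add: spread_def add.assoc)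
    qed
  qed
  have half: "spread \<psi> k s div 2 = \<psi> (s div int k)"
    if "mono \<psi>" "\<And>s. \<psi> (s + 1) \<le> \<psi> s + 1" "k \<ge> 2" for \<psi> k s
  proof -
    have "s div int k \<le> (s + 1) div int k" "(s + 1) div int k \<le> s div int k + 1"
      using zdiv_mono1[of s "s + 1" "int k"] div_unit_step(1)[of "int k" s] that(3) by auto
    then have "\<psi> (s div int k) \<le> \<psi> ((s + 1) div int k)"
      "\<psi> ((s + 1) div int k) \<le> \<psi> (s div int k) + 1"
      using monoD[OF that(1)] that(2) by (meson order_trans)+
    then show ?thesis unfolding spread_def by linarith
  qed
  have lo: "s div int k \<le> 0 \<and> (s + 1) div int k \<le> 0" if "s \<le> 0" "k \<ge> 2" for s k
    using that zdiv_mono1[of s 0 "int k"] zdiv_mono1[of "s + 1" 1 "int k"] by (simp add: div_pos_pos_trivial)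
  have hi: "int N \<le> s div int k \<and> int N \<le> (s + 1) div int k"
    if "int (k * N + k - 1) \<le> s" "k \<ge> 1" for s k N
    using div_past_end[of k N s] div_past_end[of k N "s + 1"] that by auto
  have "based_homotopic Y y0 (path_of P (\<lambda>s. g (spread \<phi> m s div 2)))
      (path_of P (\<lambda>s. g (spread (\<lambda>s. s) n s div 2)))"
  proof (rule based_homotopic_reparametrise[OF g P(2)])
    show "\<bar>spread \<phi> m s - spread \<phi> m s'\<bar> \<le> 1" if "\<bar>s - s'\<bar> \<le> 1" for s s'
      by (rule lip[OF mono step _ that]) simp
    show "\<bar>spread (\<lambda>s. s) n s - spread (\<lambda>s. s) n s'\<bar> \<le> 1" if "\<bar>s - s'\<bar> \<le> 1" for s s'
      by (rule lip[OF _ _ _ that]) (simp_all add: mono_def)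
    show "spread \<phi> m s \<le> 1 \<and> spread (\<lambda>s. s) n s \<le> 1" if "s \<le> 0" for s
      using lo[OF that, of m] lo[OF that, of n] phi_start[of "s div int m"]
        phi_start[of "(s + 1) div int m"] by (simp add: spread_def)
    show "2 * int K \<le> spread \<phi> m s \<and> 2 * int K \<le> spread (\<lambda>s. s) n s" if "int P \<le> s" for s
    proof -
      note at_m = hi[OF that[unfolded P_def] mn(1)]
      note at_n = hi[OF that[unfolded P(1)] mn(2)]
      show ?thesis
        using phi_end[OF conjunct1[OF at_m]] phi_end[OF conjunct2[OF at_m]] at_n
        unfolding spread_def by linarith
    qed
  qed
  moreover have "spread (\<lambda>s. s) n s div 2 = s div int n" for s
    by (rule half) (simp_all add: mono_def)
  moreover have "path_of L (\<lambda>s. g (\<phi> s)) \<in> based_loops Y y0"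
  proof (rule path_of_loop[OF loop_mapI L])
    show "adj (g (\<phi> s)) (g (\<phi> s'))" if "\<bar>s - s'\<bar> \<le> 1" for s s'
      by (rule loop_mapD(2)[OF g mono_unit_step_lipschitz[OF mono step that]])
    show "g (\<phi> s) = y0" if "s \<le> 0" for s
      by (rule loop_mapD(3)[OF g phi_start[OF that]])
    show "g (\<phi> s) = y0" if "int L \<le> s" for s
      by (rule loop_mapD(4)[OF g phi_end[OF that]])
  qed (rule loop_mapD(1)[OF g])
  moreover have "path_of K g \<in> based_loops Y y0"
    by (intro path_of_loop g K)
  moreover have "spread \<phi> m s div 2 = \<phi> (s div int m)" for s
    by (rule half[OF mono step]) simp
  moreover have "subdivide m (path_of L (\<lambda>s. g (\<phi> s))) = path_of P (\<lambda>s. g (\<phi> (s div int m)))"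
    unfolding P_def by (rule subdivide_path_of[OF mn(1)])
  moreover have "subdivide n (path_of K g) = path_of P (\<lambda>s. g (s div int n))"
    unfolding P(1) by (rule subdivide_path_of[OF mn(2)])
  ultimately show ?thesis
    by (intro subdiv_homotopyI[OF _ _ mn]) (simp_all only:)
qed

section \<open>The group structure\<close>

text \<open>The loop on the left runs along \<open>a \<cdot> b\<close> with the speed \<open>1 / k\<close> on the first part and
  \<open>1 / l\<close> on the second one. Its time change \<open>\<phi>\<close> also makes a single step at the seam: the last
  point \<open>A\<close> of the subdivided \<open>a\<close> goes to \<open>M\<close>, and \<open>A + 1\<close> goes to \<open>M + 1\<close>.\<close>

lemma subdiv_homotopy_concat_subdivide:
  assumes "a \<in> based_loops Y y0" and "b \<in> based_loops Y y0" and "k \<ge> 1" and "l \<ge> 1"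
  shows "(loop_concat (subdivide k a) (subdivide l b), loop_concat a b) \<in> subdiv_homotopy Y y0"
proof -
  obtain M g where a: "M \<ge> 1" "loop_map M g" "a = path_of M g"
    using loop_cases[OF assms(1)] .
  obtain N h where b: "N \<ge> 1" "loop_map N h" "b = path_of N h"
    using loop_cases[OF assms(2)] .
  define c where "c = (\<lambda>s. if s \<le> int M then g s else h (s - (int M + 1)))"
  define A where "A = k * M + k - 1"
  define B where "B = l * N + l - 1"
  have A: "int A + 1 = int k * (int M + 1)"
    using assms(3) by (auto simp: A_def algebra_simps of_nat_diff)
  define \<phi> where "\<phi> = (\<lambda>s. if s \<le> int A then s div int k
    else int M + 1 + (s - (int A + 1)) div int l)"
  have below: "s div int k \<le> int M" if "s \<le> int A" for s
    using le_div_iff_mult_le[of "int k" "int M + 1" s] that A assms(3)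
    by (auto simp: mult.commute)
  have c: "(if s \<le> int A then g (s div int k) else h ((s - (int A + 1)) div int l)) = c (\<phi> s)" for s
    using below[of s] assms(4) pos_imp_zdiv_nonneg_iff[of "int l" "s - (int A + 1)"]
    by (auto simp: c_def \<phi>_def)
  have end_A: "int A div int k = int M"
    using below[of "int A"] div_past_end[of k M "int A"] assms(3) by (simp add: A_def)
  have step: "\<phi> s \<le> \<phi> (s + 1) \<and> \<phi> (s + 1) \<le> \<phi> s + 1" for s
  proof -
    consider "s + 1 \<le> int A" | "s = int A" | "s > int A" by linarith
    then show ?thesis
    proof cases
      case 1
      then show ?thesis
        using div_unit_step(1)[of "int k" s] zdiv_mono1[of s "s + 1" "int k"] assms(3)
        by (simp add: \<phi>_def)
    next
      case 2
      then show ?thesis by (simp add: \<phi>_def end_A)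
    next
      case 3
      then show ?thesis
        using div_unit_step(1)[of "int l" "s - (int A + 1)"]
          zdiv_mono1[of "s - (int A + 1)" "s - int A" "int l"] assms(4)
        by (simp add: \<phi>_def algebra_simps)
    qed
  qed
  have "(path_of (A + B + 1) (\<lambda>s. c (\<phi> s)), path_of (M + N + 1) c) \<in> subdiv_homotopy Y y0"
  proof (rule subdiv_homotopy_reparametrise)
    show "loop_map (M + N + 1) c"
      unfolding c_def by (rule loop_map_concat[OF a(2) b(2)])
    show "mono \<phi>"
    proof (rule monoI)
      show "\<phi> x \<le> \<phi> y" if "x \<le> y" for x y
        using that by (induction rule: int_ge_induct) (auto intro: order_trans[OF _ conjunct1[OF step]])
    qed
    have "int N \<le> int B div int l"
      by (rule div_past_end[OF assms(4)]) (simp add: B_def)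
    then show "int (M + N + 1) \<le> \<phi> (int (A + B + 1))"
      by (simp add: \<phi>_def)
  qed (use step in \<open>auto simp: \<phi>_def\<close>)
  then show ?thesis
    unfolding a(3) b(3) subdivide_path_of[OF assms(3)] subdivide_path_of[OF assms(4)]
      loop_concat_path_of A_def[symmetric] B_def[symmetric] c c_def[symmetric] .
qed

lemma loop_class_eqI:
  "(a, b) \<in> subdiv_homotopy Y y0 \<Longrightarrow> loop_class Y y0 a = loop_class Y y0 b"
  unfolding loop_class_def by (rule equiv_class_eq[OF equiv_subdiv_homotopy])

text \<open>Concatenating the given homotopies joins the two products of subdivided loops, and
  \<open>subdiv_homotopy_concat_subdivide\<close> removes the subdivisions on both sides.\<close>

lemma concat_respects_subdiv_homotopy:
  "congruent2 (subdiv_homotopy Y y0) (subdiv_homotopy Y y0)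
     (\<lambda>a b. loop_class Y y0 (loop_concat a b))"
proof (rule congruent2I')
  fix a a' b b'
  assume aa': "(a, a') \<in> subdiv_homotopy Y y0" and bb': "(b, b') \<in> subdiv_homotopy Y y0"
  obtain k k' where a: "a \<in> based_loops Y y0" "a' \<in> based_loops Y y0" "k \<ge> 1" "k' \<ge> 1"
      "based_homotopic Y y0 (subdivide k a) (subdivide k' a')"
    using subdiv_homotopyE[OF aa'] .
  obtain l l' where b: "b \<in> based_loops Y y0" "b' \<in> based_loops Y y0" "l \<ge> 1" "l' \<ge> 1"
      "based_homotopic Y y0 (subdivide l b) (subdivide l' b')"
    using subdiv_homotopyE[OF bb'] .
  have "loop_class Y y0 (loop_concat a b)
      = loop_class Y y0 (loop_concat (subdivide k a) (subdivide l b))"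
    by (rule loop_class_eqI[OF subdiv_homotopy_concat_subdivide[OF a(1) b(1) a(3) b(3)], symmetric])
  also have "\<dots> = loop_class Y y0 (loop_concat (subdivide k' a') (subdivide l' b'))"
    by (intro loop_class_eqI based_homotopic_imp_subdiv_homotopy based_homotopic_concat a(5) b(5))
  also have "\<dots> = loop_class Y y0 (loop_concat a' b')"
    by (rule loop_class_eqI[OF subdiv_homotopy_concat_subdivide[OF a(2) b(2) a(4) b(4)]])
  finally show "loop_class Y y0 (loop_concat a b) = loop_class Y y0 (loop_concat a' b')" .
qed

lemma const_loop_path_of: "const_loop y0 = path_of 1 (\<lambda>_. y0)"
  by (simp add: const_loop_def path_of_def)

lemma loop_map_const: "loop_map N (\<lambda>_. y0)"
  by (rule loop_mapI) auto

lemma const_loop_loop: "const_loop y0 \<in> based_loops Y y0"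
  unfolding const_loop_path_of by (rule path_of_loop[OF loop_map_const]) simp

text \<open>A constant loop is its own reparametrisation by the identity, also across lengths.\<close>

lemma constant_subdiv_homotopic_const_loop:
  assumes "L \<ge> 1"
  shows "(path_of L (\<lambda>_. y0), const_loop y0) \<in> subdiv_homotopy Y y0"
  using subdiv_homotopy_reparametrise[OF loop_map_const[of 1] _ assms, of "\<lambda>s. s"] assms
  by (simp add: const_loop_path_of mono_def)

text \<open>\<open>const_loop y0\<close> occupies two points, so the product is \<open>a\<close> with the delayed time
  \<open>s - 2\<close>.\<close>

lemma const_loop_left_unit:
  assumes "a \<in> based_loops Y y0"
  shows "(loop_concat (const_loop y0) a, a) \<in> subdiv_homotopy Y y0"
proof -
  obtain N g where a: "N \<ge> 1" "loop_map N g" "a = path_of N g"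
    using loop_cases[OF assms] .
  have "loop_concat (const_loop y0) a = path_of (1 + N + 1) (\<lambda>s. g (s - 2))"
    unfolding const_loop_path_of a(3) loop_concat_path_of
    using loop_mapD(3)[OF a(2)] by (intro path_of_cong) auto
  then show ?thesis
    using subdiv_homotopy_reparametrise[OF a(2,1), of "1 + N + 1" "\<lambda>s. s - 2"]
    by (simp add: a(3) mono_def)
qed

lemma reverse_loop_loop:
  assumes "a \<in> based_loops Y y0"
  shows "reverse_loop a \<in> based_loops Y y0"
  using loop_mapD[OF loop_map_extend[OF assms]] assms unfolding reverse_loop_def
  by (intro path_of_loop loop_mapI) (auto simp: based_loops_def)

text \<open>The product visits \<open>g (\<psi> s)\<close> for \<open>\<psi> s = max (N - s) (s - (N + 1))\<close>, which falls from
  \<open>N\<close> to 0 and rises back to \<open>N\<close>. Raising \<open>\<psi>\<close> to the level \<open>t\<close> makes the loop turn back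
  before it reaches \<open>g 0\<close>, and at time \<open>N\<close> it does not leave the end point of \<open>g\<close>. A maximum of
  functions of \<open>s\<close> alone and of \<open>t\<close> alone stays 1-Lipschitz across diagonals, so this homotopy
  works without subdivision.\<close>

lemma reverse_loop_left_inverse:
  assumes "a \<in> based_loops Y y0"
  shows "(loop_concat (reverse_loop a) a, const_loop y0) \<in> subdiv_homotopy Y y0"
proof -
  obtain N g where a: "N \<ge> 1" "loop_map N g" "a = path_of N g"
    using loop_cases[OF assms] .
  define H where "H = (\<lambda>(s, t). g (max (max (int N - s) (s - (int N + 1))) t))"
  have "loop_homotopy (N + N + 1) H"
    using loop_mapD[OF a(2)] unfolding H_def by (intro loop_homotopyI) auto
  then have "based_homotopic Y y0 (loop_concat (reverse_loop a) a) (path_of (N + N + 1) (\<lambda>_. y0))"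
    unfolding reverse_loop_def a(3) extend_path_of[OF a(2)] fst_path_of loop_concat_path_of
  proof (rule based_homotopicI[where R = N])
    show "H (s, 0) = (if s \<le> int N then g (int N - s) else g (s - (int N + 1)))" for s
    proof -
      have "max (max (int N - s) (s - (int N + 1))) 0 =
          (if s \<le> int N then int N - s else s - (int N + 1))" by auto
      then show ?thesis by (simp add: H_def)
    qed
    show "H (s, int N) = y0" for s
      unfolding H_def prod.case by (rule loop_mapD(4)[OF a(2)]) simp
  qed simp
  then have "(loop_concat (reverse_loop a) a, path_of (N + N + 1) (\<lambda>_. y0)) \<in> subdiv_homotopy Y y0"
    by (rule based_homotopic_imp_subdiv_homotopy)
  with constant_subdiv_homotopic_const_loop[of "N + N + 1"] show ?thesis
    using equiv_subdiv_homotopy by (meson equivE transD le_add2)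
qed

lemma mult_loop_class:
  assumes "a \<in> based_loops Y y0" and "b \<in> based_loops Y y0"
  shows "loop_class Y y0 a \<otimes>\<^bsub>digital_pi1 Y y0\<^esub> loop_class Y y0 b
    = loop_class Y y0 (loop_concat a b)"
  using UN_equiv_class2[OF equiv_subdiv_homotopy equiv_subdiv_homotopy
      concat_respects_subdiv_homotopy assms]
  by (simp add: digital_pi1_def loop_class_def)

lemma carrier_digital_pi1:
  "carrier (digital_pi1 Y y0) = loop_class Y y0 ` based_loops Y y0"
  by (auto simp: digital_pi1_def quotient_def loop_class_def)

lemma group_digital_pi1: "group (digital_pi1 Y y0)"
proof (rule groupI)
  let ?G = "digital_pi1 Y y0"
  note classes = carrier_digital_pi1 mult_loop_class loop_concat_loop const_loop_loop
  have one: "\<one>\<^bsub>?G\<^esub> = loop_class Y y0 (const_loop y0)"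
    by (simp add: digital_pi1_def)
  show "x \<otimes>\<^bsub>?G\<^esub> y \<in> carrier ?G" if "x \<in> carrier ?G" "y \<in> carrier ?G" for x y
    using that by (auto simp: classes)
  show "\<one>\<^bsub>?G\<^esub> \<in> carrier ?G"
    by (simp add: classes one)
  show "x \<otimes>\<^bsub>?G\<^esub> y \<otimes>\<^bsub>?G\<^esub> z = x \<otimes>\<^bsub>?G\<^esub> (y \<otimes>\<^bsub>?G\<^esub> z)"
    if "x \<in> carrier ?G" "y \<in> carrier ?G" "z \<in> carrier ?G" for x y z
    using that by (auto simp: classes loop_concat_assoc)
  show "\<one>\<^bsub>?G\<^esub> \<otimes>\<^bsub>?G\<^esub> x = x" if "x \<in> carrier ?G" for x
    using that loop_class_eqI[OF const_loop_left_unit] by (auto simp: classes one simp del: split_paired_All)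
  show "\<exists>y\<in>carrier ?G. y \<otimes>\<^bsub>?G\<^esub> x = \<one>\<^bsub>?G\<^esub>" if x: "x \<in> carrier ?G" for x
  proof -
    obtain a where a: "a \<in> based_loops Y y0" "x = loop_class Y y0 a"
      using x unfolding carrier_digital_pi1 by (elim imageE)
    then show ?thesis
      using reverse_loop_loop[OF a(1)] loop_class_eqI[OF reverse_loop_left_inverse[OF a(1)]]
      by (intro bexI[where x = "loop_class Y y0 (reverse_loop a)"]) (simp_all add: classes one)
  qed
qed

end

theorem theorem3p10:
  fixes Y :: "(int ^ 'n) set" and y0 :: "int ^ 'n"
  assumes "finite Y" and "y0 \<in> Y"
  shows "group (digital_pi1 Y y0) \<and>
    (\<forall>a\<in>based_loops Y y0. \<forall>b\<in>based_loops Y y0.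
       loop_class Y y0 a \<otimes>\<^bsub>digital_pi1 Y y0\<^esub> loop_class Y y0 b
         = loop_class Y y0 (loop_concat a b))"
proof -
  interpret pointed_image Y y0
    by unfold_locales (rule assms(2))
  show ?thesis
    using group_digital_pi1 mult_loop_class by blast
qed

end
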